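(* Let $\mu$ be a probabilistic frame for $\mathbb{R}^n$ with bounds $0<A\le B$ and let $\nu\in\mathcal{P}_2(\mathbb{R}^n)$. Suppose there exist $\lambda_1,\lambda_2,\delta\ge 0$ such that $\max\left(\lambda_1+\frac{\delta}{\sqrt{A}},\lambda_2\right)<1$ and for all $w\in C_c(\mathbb{R}^n)$, $$\left\Vert \int_{\mathbb{R}^n} w(\mathbf{x})\mathbf{x}\,d\mu(\mathbf{x}) - \int_{\mathbb{R}^n} w(\mathbf{y})\mathbf{y}\,d\nu(\mathbf{y})\right\Vert \le \lambda_1\left\Vert \int_{\mathbb{R}^n} w(\mathbf{x})\mathbf{x}\,d\mu(\mathbf{x})\right\Vert + \lambda_2 \left\Vert \int_{\mathbb{R}^n} w(\mathbf{y})\mathbf{y}\,d\nu(\mathbf{y})\right\Vert + \delta\Vert w\Vert_{L^2(\mu)}.$$ Then $\nu$ is a probabilistic frame for $\mathbb{R}^n$ with bounds $$\frac{A^2\left(1-\left(\lambda_1+\frac{\delta}{\sqrt{A}}\right)\right)^2}{(1+\lambda_2)^2 M_2(\nu)}\quad\text{and}\quad M_2(\nu).$$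
   Context: $\mathcal{P}(\mathbb{R}^n)$ is the set of Borel probability measures on $\mathbb{R}^n$ and $\Vert\cdot\Vert$ is the Euclidean norm. The second moment of $\mu\in\mathcal{P}(\mathbb{R}^n)$ is $M_2(\mu) := \int_{\mathbb{R}^n}\Vert \mathbf{x}\Vert^2 d\mu(\mathbf{x})$, and $\mathcal{P}_2(\mathbb{R}^n)$ is the set of $\mu \in \mathcal{P}(\mathbb{R}^n)$ with $M_2(\mu)<+\infty$. $C_c(\mathbb{R}^n)$ is the set of continuous (real-valued) functions on $\mathbb{R}^n$ with compact support, and $\Vert w\Vert_{L^2(\mu)} = \left(\int_{\mathbb{R}^n} |w|^2 d\mu\right)^{1/2}$. A measure $\mu\in\mathcal{P}(\mathbb{R}^n)$ is a probabilistic frame for $\mathbb{R}^n$ with (frame) bounds $A$ and $B$, where $0<A\le B<\infty$, if for every $\mathbf{x}\in\mathbb{R}^n$, $A\Vert\mathbf{x}\Vert^2 \le \int_{\mathbb{R}^n} |\langle \mathbf{x},\mathbf{y}\rangle|^2 d\mu(\mathbf{y}) \le B\Vert\mathbf{x}\Vert^2$; $A$ is called a lower and $B$ an upper frame bound (the bounds need not be optimal). *)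

theory Defs
  imports "HOL-Probability.Probability"
begin

definition borel_prob :: "'a::euclidean_space measure set" where
  "borel_prob = {\<mu>. prob_space \<mu> \<and> sets \<mu> = sets borel}"

definition second_moment :: "'a::euclidean_space measure \<Rightarrow> ennreal" where
  "second_moment \<mu> = (\<integral>\<^sup>+x. ennreal ((norm x)\<^sup>2) \<partial>\<mu>)"

definition borel_prob2 :: "'a::euclidean_space measure set" where
  "borel_prob2 = {\<mu> \<in> borel_prob. second_moment \<mu> < \<infinity>}"

definition continuous_compact_support :: "('a::euclidean_space \<Rightarrow> real) set" where
  "continuous_compact_support =
     {w. continuous_on UNIV w \<and> compact (closure (support_on UNIV w))}"

definition L2_norm :: "'a measure \<Rightarrow> ('a \<Rightarrow> real) \<Rightarrow> real" where
  "L2_norm \<mu> w = sqrt (\<integral>x. \<bar>w x\<bar>\<^sup>2 \<partial>\<mu>)"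

text \<open>The frame inequalities use the extended nonnegative integral, so that a non-integrable
  \<open>y \<mapsto> \<bar>x \<bullet> y\<bar>\<^sup>2\<close> has integral \<open>\<infinity>\<close> rather than the Bochner default value \<open>0\<close>.\<close>

definition probabilistic_frame ::
    "'a::euclidean_space measure \<Rightarrow> real \<Rightarrow> real \<Rightarrow> bool" where
  "probabilistic_frame \<mu> A B \<longleftrightarrow>
     \<mu> \<in> borel_prob \<and> 0 < A \<and> A \<le> B \<and>
     (\<forall>x. ennreal (A * (norm x)\<^sup>2) \<le> (\<integral>\<^sup>+y. ennreal (\<bar>x \<bullet> y\<bar>\<^sup>2) \<partial>\<mu>) \<and>
          (\<integral>\<^sup>+y. ennreal (\<bar>x \<bullet> y\<bar>\<^sup>2) \<partial>\<mu>) \<le> ennreal (B * (norm x)\<^sup>2))"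

end

theory Submission
  imports Defs
begin

text \<open>
  Write \<open>S\<^sub>\<mu> z = \<integral> (z \<bullet> y) y d\<mu>(y)\<close> for the frame operator. The perturbation inequality is meant
  to be read with the weight \<open>w = (z \<bullet> _)\<close>, for which the two vectors being compared are
  \<open>S\<^sub>\<mu> z\<close> and \<open>S\<^sub>\<nu> z\<close>. This \<open>w\<close> lacks compact support, but cutting it off and letting the cutoff
  tend to \<open>1\<close> is harmless: \<open>\<mu>\<close> and \<open>\<nu>\<close> have finite second moments (\<open>\<mu>\<close> because the second
  moment is the trace of the frame operator), so dominated convergence applies to every term
  of the inequality.

  Since \<open>A \<parallel>z\<parallel>\<^sup>2 \<le> S\<^sub>\<mu> z \<bullet> z \<le> \<parallel>S\<^sub>\<mu> z\<parallel> \<parallel>z\<parallel>\<close>, one has \<open>A \<parallel>z\<parallel> \<le> \<parallel>S\<^sub>\<mu> z\<parallel>\<close>, and the \<open>L\<^sup>2(\<mu>)\<close> norm of \<open>w\<close>, which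
  is the square root of \<open>S\<^sub>\<mu> z \<bullet> z \<le> \<parallel>S\<^sub>\<mu> z\<parallel> \<parallel>z\<parallel> \<le> \<parallel>S\<^sub>\<mu> z\<parallel>\<^sup>2 / A\<close>, is at most \<open>\<parallel>S\<^sub>\<mu> z\<parallel> / \<surd>A\<close>. The inequality thus becomes
  \<open>(1 - (\<lambda>\<^sub>1 + \<delta> / \<surd>A)) \<parallel>S\<^sub>\<mu> z\<parallel> \<le> (1 + \<lambda>\<^sub>2) \<parallel>S\<^sub>\<nu> z\<parallel>\<close>, which bounds \<open>\<parallel>S\<^sub>\<nu> z\<parallel>\<close> below by a multiple
  of \<open>\<parallel>z\<parallel>\<close>. Finally, \<open>S\<^sub>\<nu>\<close> is positive semidefinite with \<open>S\<^sub>\<nu> u \<bullet> u \<le> M\<^sub>2(\<nu>) \<parallel>u\<parallel>\<^sup>2\<close>, so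
  \<open>\<parallel>S\<^sub>\<nu> z\<parallel>\<^sup>2 \<le> M\<^sub>2(\<nu>) (S\<^sub>\<nu> z \<bullet> z)\<close>, which turns the lower bound on the vector \<open>S\<^sub>\<nu> z\<close> into the lower
  frame bound.
\<close>

section \<open>The frame operator of a measure with finite second moment\<close>

definition frame_operator :: "'a::euclidean_space measure \<Rightarrow> 'a \<Rightarrow> 'a" where
  "frame_operator \<mu> z = (\<integral>y. (z \<bullet> y) *\<^sub>R y \<partial>\<mu>)"

lemma integrable_norm_power2_iff_second_moment:
  fixes \<mu> :: "'a::euclidean_space measure"
  assumes "sets \<mu> = sets borel"
  shows "integrable \<mu> (\<lambda>y. (norm y)\<^sup>2) \<longleftrightarrow> second_moment \<mu> < \<infinity>"
proof -
  have [measurable_cong]: "sets \<mu> = sets borel" by fact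
  show ?thesis
    by (subst integrable_iff_bounded) (simp add: second_moment_def)
qed

lemma enn2real_second_moment:
  fixes \<mu> :: "'a::euclidean_space measure"
  assumes "sets \<mu> = sets borel"
  shows "enn2real (second_moment \<mu>) = (\<integral>y. (norm y)\<^sup>2 \<partial>\<mu>)"
proof -
  have [measurable_cong]: "sets \<mu> = sets borel" by fact
  show ?thesis
    unfolding second_moment_def by (subst integral_eq_nn_integral) auto
qed

lemma
  fixes \<mu> :: "'a::euclidean_space measure"
  assumes [measurable_cong]: "sets \<mu> = sets borel"
    and int: "integrable \<mu> (\<lambda>y. (norm y)\<^sup>2)"
  shows integrable_frame_operator: "integrable \<mu> (\<lambda>y. (z \<bullet> y) *\<^sub>R y)"
    and integrable_inner_power2: "integrable \<mu> (\<lambda>y. (z \<bullet> y)\<^sup>2)"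
proof -
  have int': "integrable \<mu> (\<lambda>y. norm z * (norm y)\<^sup>2)"
    using int by simp
  have "norm ((z \<bullet> y) *\<^sub>R y) \<le> norm (norm z * (norm y)\<^sup>2)" for y
    using mult_right_mono[OF Cauchy_Schwarz_ineq2[of z y] norm_ge_zero[of y]]
    by (simp add: power2_eq_square mult.assoc)
  then show "integrable \<mu> (\<lambda>y. (z \<bullet> y) *\<^sub>R y)"
    by (intro Bochner_Integration.integrable_bound[OF int']) auto
  then have "integrable \<mu> (\<lambda>y. ((z \<bullet> y) *\<^sub>R y) \<bullet> z)"
    by (rule integrable_inner_left)
  then show "integrable \<mu> (\<lambda>y. (z \<bullet> y)\<^sup>2)"
    by (simp add: power2_eq_square inner_commute)
qed

lemma inner_frame_operator:
  fixes \<mu> :: "'a::euclidean_space measure"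
  assumes "sets \<mu> = sets borel" "integrable \<mu> (\<lambda>y. (norm y)\<^sup>2)"
  shows "frame_operator \<mu> z \<bullet> u = (\<integral>y. (z \<bullet> y) * (u \<bullet> y) \<partial>\<mu>)"
  using integral_inner_left[OF integrable_frame_operator[OF assms], of z u]
  by (simp add: frame_operator_def inner_commute)

lemma inner_frame_operator_self:
  fixes \<mu> :: "'a::euclidean_space measure"
  assumes "sets \<mu> = sets borel" "integrable \<mu> (\<lambda>y. (norm y)\<^sup>2)"
  shows "frame_operator \<mu> z \<bullet> z = (\<integral>y. (z \<bullet> y)\<^sup>2 \<partial>\<mu>)"
  by (simp add: inner_frame_operator[OF assms] power2_eq_square)

lemma inner_frame_operator_self_le:
  fixes \<mu> :: "'a::euclidean_space measure"
  assumes "sets \<mu> = sets borel" "integrable \<mu> (\<lambda>y. (norm y)\<^sup>2)"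
  shows "frame_operator \<mu> z \<bullet> z \<le> (\<integral>y. (norm y)\<^sup>2 \<partial>\<mu>) * (norm z)\<^sup>2"
proof -
  have "(z \<bullet> y)\<^sup>2 \<le> (norm y)\<^sup>2 * (norm z)\<^sup>2" for y
    using Cauchy_Schwarz_ineq[of z y] by (simp add: power2_norm_eq_inner mult.commute)
  then have "(\<integral>y. (z \<bullet> y)\<^sup>2 \<partial>\<mu>) \<le> (\<integral>y. (norm y)\<^sup>2 * (norm z)\<^sup>2 \<partial>\<mu>)"
    using assms(2) by (intro integral_mono integrable_inner_power2[OF assms]) auto
  then show ?thesis
    by (simp add: inner_frame_operator_self[OF assms])
qed

text \<open>
  The lower bounds on \<open>S z \<bullet> z\<close> come from expanding \<open>0 \<le> S u \<bullet> u\<close> at \<open>u = z - t S z\<close>;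
  keeping \<open>t\<close> free covers a vanishing second moment as well.
\<close>

lemma frame_operator_quadratic_bound:
  fixes \<mu> :: "'a::euclidean_space measure"
  assumes "sets \<mu> = sets borel" "integrable \<mu> (\<lambda>y. (norm y)\<^sup>2)"
  shows "2 * t * (norm (frame_operator \<mu> z))\<^sup>2 \<le>
           frame_operator \<mu> z \<bullet> z
           + t\<^sup>2 * ((\<integral>y. (norm y)\<^sup>2 \<partial>\<mu>) * (norm (frame_operator \<mu> z))\<^sup>2)"
proof -
  define s where "s = frame_operator \<mu> z"
  have prod: "integrable \<mu> (\<lambda>y. (z \<bullet> y) * (s \<bullet> y))"
    using integrable_inner_left[OF integrable_frame_operator[OF assms], of z s]
    by (simp add: inner_commute)
  note [simp] = prod integrable_inner_power2[OF assms]
  have eq: "((z - t *\<^sub>R s) \<bullet> y)\<^sup>2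
      = (z \<bullet> y)\<^sup>2 - 2 * t * ((z \<bullet> y) * (s \<bullet> y)) + t\<^sup>2 * (s \<bullet> y)\<^sup>2" for y
    by (simp add: inner_diff_left power2_eq_square algebra_simps)
  have "0 \<le> (\<integral>y. ((z - t *\<^sub>R s) \<bullet> y)\<^sup>2 \<partial>\<mu>)" by simp
  also have "\<dots> = frame_operator \<mu> z \<bullet> z - 2 * t * (frame_operator \<mu> z \<bullet> s)
      + t\<^sup>2 * (frame_operator \<mu> s \<bullet> s)"
    unfolding eq inner_frame_operator_self[OF assms] inner_frame_operator[OF assms, of z s]
    by simp
  also have "\<dots> \<le> frame_operator \<mu> z \<bullet> z - 2 * t * (norm s)\<^sup>2
      + t\<^sup>2 * ((\<integral>y. (norm y)\<^sup>2 \<partial>\<mu>) * (norm s)\<^sup>2)"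
    using mult_left_mono[OF inner_frame_operator_self_le[OF assms, of s], of "t\<^sup>2"]
    by (simp add: s_def[symmetric] power2_norm_eq_inner)
  finally show ?thesis by (simp add: s_def)
qed

section \<open>Probabilistic frames\<close>

text \<open>The second moment is the trace of the frame operator, so an upper frame bound makes it finite.\<close>

lemma probabilistic_frame_integrable_norm_power2:
  fixes \<mu> :: "'a::euclidean_space measure"
  assumes "probabilistic_frame \<mu> A B"
  shows "integrable \<mu> (\<lambda>y. (norm y)\<^sup>2)"
proof -
  have [measurable_cong]: "sets \<mu> = sets borel"
    using assms by (simp add: probabilistic_frame_def borel_prob_def)
  have "integrable \<mu> (\<lambda>y. (b \<bullet> y)\<^sup>2)" for b
  proof -
    have "(\<integral>\<^sup>+y. ennreal (\<bar>b \<bullet> y\<bar>\<^sup>2) \<partial>\<mu>) \<le> ennreal (B * (norm b)\<^sup>2)"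
      using assms by (simp add: probabilistic_frame_def)
    also have "\<dots> < \<infinity>" by simp
    finally show ?thesis
      by (subst integrable_iff_bounded) simp
  qed
  then have "integrable \<mu> (\<lambda>y. \<Sum>b\<in>Basis. (b \<bullet> y)\<^sup>2)"
    by (intro Bochner_Integration.integrable_sum)
  moreover have "(\<Sum>b\<in>Basis. (b \<bullet> y)\<^sup>2) = (norm y)\<^sup>2" for y :: 'a
    unfolding norm_eq_sqrt_inner euclidean_inner[of y y]
    by (simp add: power2_eq_square inner_commute sum_nonneg)
  ultimately show ?thesis by simp
qed

lemma probabilistic_frame_iff_frame_operator:
  fixes \<mu> :: "'a::euclidean_space measure"
  assumes "\<mu> \<in> borel_prob" "integrable \<mu> (\<lambda>y. (norm y)\<^sup>2)"
  shows "probabilistic_frame \<mu> A B \<longleftrightarrow>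
     0 < A \<and> A \<le> B \<and>
     (\<forall>x. A * (norm x)\<^sup>2 \<le> frame_operator \<mu> x \<bullet> x \<and>
          frame_operator \<mu> x \<bullet> x \<le> B * (norm x)\<^sup>2)"
proof -
  have sets: "sets \<mu> = sets borel"
    using assms by (simp add: borel_prob_def)
  have "(\<integral>\<^sup>+y. ennreal (\<bar>x \<bullet> y\<bar>\<^sup>2) \<partial>\<mu>) = ennreal (frame_operator \<mu> x \<bullet> x)" for x
    using nn_integral_eq_integral[OF integrable_inner_power2[OF sets assms(2), of x]]
    by (simp add: inner_frame_operator_self[OF sets assms(2)])
  moreover have "0 \<le> frame_operator \<mu> x \<bullet> x" for x
    by (simp add: inner_frame_operator_self[OF sets assms(2)])
  ultimately show ?thesis
    unfolding probabilistic_frame_def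
    using assms(1) by (auto simp: ennreal_le_iff)
qed

section \<open>Testing against linear weights\<close>

definition cutoff :: "nat \<Rightarrow> 'a::euclidean_space \<Rightarrow> real" where
  "cutoff k y = max 0 (min 1 (real k - norm y))"

lemma continuous_on_cutoff: "continuous_on UNIV (cutoff k)"
  unfolding cutoff_def by (intro continuous_intros)

lemma borel_measurable_cutoff [measurable]: "cutoff k \<in> borel_measurable borel"
  by (rule borel_measurable_continuous_onI[OF continuous_on_cutoff])

lemma cutoff_nonneg: "0 \<le> cutoff k y" and cutoff_le_1: "cutoff k y \<le> 1"
  by (auto simp: cutoff_def)

lemma eventually_cutoff_eq_1: "eventually (\<lambda>k. cutoff k y = 1) sequentially"
proof -
  obtain N :: nat where N: "norm y + 1 \<le> real N"
    using real_arch_simple by blast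
  have "cutoff k y = 1" if "k \<ge> N" for k
    using that N by (auto simp: cutoff_def)
  then show ?thesis
    by (auto simp: eventually_sequentially)
qed

lemma continuous_compact_support_cutoff_mult:
  assumes "continuous_on UNIV f"
  shows "(\<lambda>y. cutoff k y * f y) \<in> continuous_compact_support"
proof -
  have "support_on UNIV (\<lambda>y. cutoff k y * f y) \<subseteq> cball (0::'a) (real k)"
    by (auto simp: support_on_def cutoff_def max_def split: if_splits)
  then have "bounded (support_on UNIV (\<lambda>y. cutoff k y * f y))"
    using bounded_cball bounded_subset by blast
  moreover have "continuous_on UNIV (\<lambda>y. cutoff k y * f y)"
    by (intro continuous_intros continuous_on_cutoff assms)
  ultimately show ?thesis
    by (simp add: continuous_compact_support_def compact_closure)
qed

text \<open>The squared cutoff is the factor that occurs in the \<open>L\<^sup>2\<close> norm of a cut-off weight.\<close>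

lemma tendsto_integral_cutoff:
  fixes f :: "'a::euclidean_space \<Rightarrow> 'b::{banach, second_countable_topology}"
  assumes [measurable_cong]: "sets \<mu> = sets borel" and int: "integrable \<mu> f"
  shows "(\<lambda>k. \<integral>y. cutoff k y *\<^sub>R f y \<partial>\<mu>) \<longlonglongrightarrow> (\<integral>y. f y \<partial>\<mu>)"
    and "(\<lambda>k. \<integral>y. (cutoff k y)\<^sup>2 *\<^sub>R f y \<partial>\<mu>) \<longlonglongrightarrow> (\<integral>y. f y \<partial>\<mu>)"
proof -
  have [measurable]: "f \<in> borel_measurable \<mu>"
    using int by simp
  have sq: "(cutoff k y)\<^sup>2 \<le> 1" for k and y :: 'a
    by (intro power_le_one cutoff_nonneg cutoff_le_1)
  have ev: "eventually (\<lambda>k. cutoff k y *\<^sub>R f y = f y) sequentially"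
    "eventually (\<lambda>k. (cutoff k y)\<^sup>2 *\<^sub>R f y = f y) sequentially" for y
    using eventually_cutoff_eq_1[of y] by (auto elim!: eventually_mono)
  show "(\<lambda>k. \<integral>y. cutoff k y *\<^sub>R f y \<partial>\<mu>) \<longlonglongrightarrow> (\<integral>y. f y \<partial>\<mu>)"
    by (rule integral_dominated_convergence[where w="\<lambda>y. norm (f y)"])
      (use int in \<open>auto simp: cutoff_nonneg cutoff_le_1 mult_left_le_one_le
          intro!: tendsto_eventually ev\<close>)
  show "(\<lambda>k. \<integral>y. (cutoff k y)\<^sup>2 *\<^sub>R f y \<partial>\<mu>) \<longlonglongrightarrow> (\<integral>y. f y \<partial>\<mu>)"
    by (rule integral_dominated_convergence[where w="\<lambda>y. norm (f y)"])
      (use int in \<open>auto simp: sq mult_left_le_one_le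
          intro!: tendsto_eventually ev\<close>)
qed

text \<open>
  Every term of the perturbation inequality at \<open>w = cutoff k \<cdot> (z \<bullet> _)\<close> converges as \<open>k \<rightarrow> \<infinity>\<close>,
  so the inequality extends to the weight \<open>(z \<bullet> _)\<close>.
\<close>

lemma perturbation_inequality_frame_operator:
  fixes \<mu> \<nu> :: "'a::euclidean_space measure"
  assumes mu: "sets \<mu> = sets borel" "integrable \<mu> (\<lambda>y. (norm y)\<^sup>2)"
    and nu: "sets \<nu> = sets borel" "integrable \<nu> (\<lambda>y. (norm y)\<^sup>2)"
    and ineq: "\<forall>w \<in> continuous_compact_support.
           norm ((\<integral>x. w x *\<^sub>R x \<partial>\<mu>) - (\<integral>y. w y *\<^sub>R y \<partial>\<nu>))
             \<le> a * norm (\<integral>x. w x *\<^sub>R x \<partial>\<mu>)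
               + b * norm (\<integral>y. w y *\<^sub>R y \<partial>\<nu>)
               + c * L2_norm \<mu> w"
  shows "norm (frame_operator \<mu> z - frame_operator \<nu> z)
           \<le> a * norm (frame_operator \<mu> z) + b * norm (frame_operator \<nu> z)
             + c * sqrt (frame_operator \<mu> z \<bullet> z)"
proof -
  let ?w = "\<lambda>k y. cutoff k y * (z \<bullet> y)"
  have op: "(\<lambda>k. \<integral>y. ?w k y *\<^sub>R y \<partial>\<rho>) \<longlonglongrightarrow> frame_operator \<rho> z"
    if "sets \<rho> = sets borel" "integrable \<rho> (\<lambda>y. (norm y)\<^sup>2)" for \<rho>
    using tendsto_integral_cutoff(1)[OF that(1) integrable_frame_operator[OF that, of z]]
    by (simp add: frame_operator_def)
  have L2: "(\<lambda>k. L2_norm \<mu> (?w k)) \<longlonglongrightarrow> sqrt (frame_operator \<mu> z \<bullet> z)"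
    unfolding L2_norm_def inner_frame_operator_self[OF mu]
    using tendsto_real_sqrt[OF tendsto_integral_cutoff(2)[OF mu(1) integrable_inner_power2[OF mu, of z]]]
    by (simp add: power_mult_distrib)
  have "norm ((\<integral>x. ?w k x *\<^sub>R x \<partial>\<mu>) - (\<integral>y. ?w k y *\<^sub>R y \<partial>\<nu>))
      \<le> a * norm (\<integral>x. ?w k x *\<^sub>R x \<partial>\<mu>) + b * norm (\<integral>y. ?w k y *\<^sub>R y \<partial>\<nu>)
        + c * L2_norm \<mu> (?w k)" for k
    by (rule bspec[OF ineq]) (intro continuous_compact_support_cutoff_mult continuous_intros)
  then show ?thesis
    by (intro LIMSEQ_le[OF tendsto_norm[OF tendsto_diff[OF op[OF mu] op[OF nu]]]
          tendsto_add[OF tendsto_add[OF tendsto_mult[OF tendsto_const tendsto_norm[OF op[OF mu]]]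
              tendsto_mult[OF tendsto_const tendsto_norm[OF op[OF nu]]]]
            tendsto_mult[OF tendsto_const L2]]]) auto
qed

section \<open>Stability of the frame property\<close>

theorem theorem3p3:
  fixes \<mu> \<nu> :: "(real ^ 'n) measure"
    and A B lam1 lam2 \<delta> :: real
  assumes "probabilistic_frame \<mu> A B"
    and "\<nu> \<in> borel_prob2"
    and "lam1 \<ge> 0" and "lam2 \<ge> 0" and "\<delta> \<ge> 0"
    and "max (lam1 + \<delta> / sqrt A) lam2 < 1"
    and "\<forall>w \<in> continuous_compact_support.
           norm ((\<integral>x. w x *\<^sub>R x \<partial>\<mu>) - (\<integral>y. w y *\<^sub>R y \<partial>\<nu>))
             \<le> lam1 * norm (\<integral>x. w x *\<^sub>R x \<partial>\<mu>)
               + lam2 * norm (\<integral>y. w y *\<^sub>R y \<partial>\<nu>)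
               + \<delta> * L2_norm \<mu> w"
  shows "probabilistic_frame \<nu>
           (A\<^sup>2 * (1 - (lam1 + \<delta> / sqrt A))\<^sup>2 / ((1 + lam2)\<^sup>2 * enn2real (second_moment \<nu>)))
           (enn2real (second_moment \<nu>))"
proof -
  have mu_prob: "\<mu> \<in> borel_prob" and A: "0 < A"
    using assms(1) by (auto simp: probabilistic_frame_def)
  have nu_prob: "\<nu> \<in> borel_prob"
    using assms(2) by (simp add: borel_prob2_def)
  have mu: "sets \<mu> = sets borel" "integrable \<mu> (\<lambda>y. (norm y)\<^sup>2)"
    using mu_prob probabilistic_frame_integrable_norm_power2[OF assms(1)]
    by (auto simp: borel_prob_def)
  have nu: "sets \<nu> = sets borel" "integrable \<nu> (\<lambda>y. (norm y)\<^sup>2)"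
    using assms(2) integrable_norm_power2_iff_second_moment[of \<nu>]
    by (auto simp: borel_prob_def borel_prob2_def)
  let ?S = "frame_operator \<mu>" and ?T = "frame_operator \<nu>"
  define M where "M = enn2real (second_moment \<nu>)"
  have M_eq: "M = (\<integral>y. (norm y)\<^sup>2 \<partial>\<nu>)"
    unfolding M_def by (rule enn2real_second_moment[OF nu(1)])
  define c where "c = 1 - (lam1 + \<delta> / sqrt A)"
  have c: "0 < c" using assms(6) by (simp add: c_def)
  define K where "K = A * c / (1 + lam2)"
  have K: "0 < K" using A c assms(4) by (simp add: K_def)

  have lower_S: "A * (norm z)\<^sup>2 \<le> ?S z \<bullet> z" for z
    using assms(1) probabilistic_frame_iff_frame_operator[OF mu_prob mu(2)] by blast
  have norm_S: "A * norm z \<le> norm (?S z)" for z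
  proof (cases "z = 0")
    case False
    have "A * norm z * norm z \<le> norm (?S z) * norm z"
      using lower_S[of z] norm_cauchy_schwarz[of "?S z" z] by (simp add: power2_eq_square)
    then show ?thesis using False by simp
  qed simp
  have weight_norm: "sqrt (?S z \<bullet> z) \<le> norm (?S z) / sqrt A" for z
  proof (rule real_le_lsqrt)
    have "A * (?S z \<bullet> z) \<le> A * (norm (?S z) * norm z)"
      using norm_cauchy_schwarz[of "?S z" z] A by simp
    also have "\<dots> \<le> (norm (?S z))\<^sup>2"
      using mult_left_mono[OF norm_S[of z] norm_ge_zero[of "?S z"]]
      by (simp add: power2_eq_square mult_ac)
    finally show "?S z \<bullet> z \<le> (norm (?S z) / sqrt A)\<^sup>2"
      using A by (simp add: power_divide field_simps)
  qed (use A in simp)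

  have norm_T: "K * norm z \<le> norm (?T z)" for z
  proof -
    have "norm (?S z) \<le> norm (?T z) + norm (?S z - ?T z)"
      using norm_triangle_sub by blast
    also have "\<dots> \<le> norm (?T z) + (lam1 * norm (?S z) + lam2 * norm (?T z)
        + \<delta> * (norm (?S z) / sqrt A))"
      using perturbation_inequality_frame_operator[OF mu nu assms(7), of z]
        mult_left_mono[OF weight_norm[of z] assms(5)] by linarith
    finally have "c * norm (?S z) \<le> (1 + lam2) * norm (?T z)"
      by (simp add: c_def algebra_simps)
    then have "c * (A * norm z) \<le> (1 + lam2) * norm (?T z)"
      using mult_left_mono[OF norm_S[of z], of c] c by linarith
    then show ?thesis
      using assms(4) by (simp add: K_def field_simps)
  qed

  obtain e :: "real ^ 'n" where e: "norm e = 1"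
    using norm_Basis nonempty_Basis by blast
  have upper_T: "?T z \<bullet> z \<le> M * (norm z)\<^sup>2" for z
    using inner_frame_operator_self_le[OF nu] by (simp add: M_eq)
  have M_pos: "0 < M"
  proof (rule ccontr)
    assume "\<not> 0 < M"
    then have "M = 0"
      using enn2real_nonneg[of "second_moment \<nu>"] by (simp add: M_def)
    then have "2 * (norm (?T e))\<^sup>2 \<le> ?T e \<bullet> e" "?T e \<bullet> e \<le> 0"
      using frame_operator_quadratic_bound[OF nu, of 1 e] upper_T[of e] by (simp_all add: M_eq)
    then have "(norm (?T e))\<^sup>2 \<le> 0" by linarith
    then show False
      using norm_T[of e] K e by simp
  qed
  have lower_T: "K\<^sup>2 / M * (norm z)\<^sup>2 \<le> ?T z \<bullet> z" for z
  proof -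
    have "(K * norm z)\<^sup>2 \<le> (norm (?T z))\<^sup>2"
      using norm_T[of z] K by (intro power_mono) auto
    then have "K\<^sup>2 / M * (norm z)\<^sup>2 \<le> (norm (?T z))\<^sup>2 / M"
      using M_pos by (simp add: power_mult_distrib divide_right_mono)
    also have "\<dots> \<le> ?T z \<bullet> z"
      \<comment> \<open>\<open>t = 1 / M\<close> minimizes the quadratic polynomial in \<open>t\<close>\<close>
      using frame_operator_quadratic_bound[OF nu, of "1 / M" z, folded M_eq] M_pos
      by (simp add: power2_eq_square)
    finally show ?thesis .
  qed
  have "probabilistic_frame \<nu> (K\<^sup>2 / M) M"
    unfolding probabilistic_frame_iff_frame_operator[OF nu_prob nu(2)]
    using lower_T upper_T K M_pos order_trans[OF lower_T[of e] upper_T[of e]] e by simp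
  then show ?thesis
    by (simp add: K_def c_def M_def power_mult_distrib power_divide)
qed

end
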